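(* Let $G=G_1\oplus G_2$ and let $F_1=((x_1,1),\dots,(x_n,1),(y_1,z_1),\dots,(y_m,z_m))$ and $F_2=((x_1',1),\dots,(x_n',1),(y_1',z_1),\dots,(y_m',z_m))$ be factorizations in $G$ (with $x_i,x_i',y_i,y_i'\in G_1$, $z_i\in G_2$). Let $K=\langle x_1,\dots,x_n,y_1,\dots,y_m\rangle\le G_1$ and let $N$ be the normal closure of $\{x_1,\dots,x_n\}$ in $K$. (1) If $F_1$ and $F_2$ are Hurwitz equivalent and $z_i\neq1$ for all $i$, then there is a permutation $\pi\in S_n$ such that for every $i$, $1\le i\le n$, $x_i'$ is conjugate to $x_{\pi(i)}$ in $K$ (in particular $x_i'\in N$). (2) If in addition the stabilizer of $(z_1,\dots,z_m)$ under the Hurwitz braid action is contained in the stabilizer of $(y_1,\dots,y_m)$ (both subgroups of $B_m$), then for every $i$, $1\le i\le m$, there is an element $m_i\in N$ such that $y_i'=y_i^{m_i}$.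
   Context: Conjugation notation: $a^b=b^{-1}ab$. The braid group $B_k$ (generators $\sigma_1,\dots,\sigma_{k-1}$) acts on the right on tuples of group elements by $(f_1,\dots,f_k)\sigma_i=(f_1,\dots,f_{i-1},f_{i+1},f_{i+1}^{-1}f_if_{i+1},f_{i+2},\dots,f_k)$, $(f_1,\dots,f_k)\sigma_i^{-1}=(f_1,\dots,f_{i-1},f_if_{i+1}f_i^{-1},f_i,f_{i+2},\dots,f_k)$ (Hurwitz braid action); Hurwitz equivalent means in the same orbit. *)

theory Defs
  imports "HOL-Algebra.Generated_Groups" "HOL-Algebra.Group_Action" "HOL-Combinatorics.Permutations"
begin

section \<open>Braid groups\<close>

text \<open>
  Indices start at 0 throughout: the letter \<open>(i, True)\<close> is the usual generator
  \<open>\<sigma>\<close> with index \<open>i + 1\<close>, exchanging strands \<open>i\<close> and \<open>i + 1\<close> out of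
  \<open>0, \<dots>, k - 1\<close>, and \<open>(i, False)\<close> is its inverse.
\<close>

type_synonym braid_word = "(nat \<times> bool) list"

definition braid_words :: "nat \<Rightarrow> braid_word set" where
  "braid_words k = {w. \<forall>(i, e) \<in> set w. Suc i < k}"

inductive braid_eq :: "nat \<Rightarrow> braid_word \<Rightarrow> braid_word \<Rightarrow> bool" for k :: nat where
  refl: "w \<in> braid_words k \<Longrightarrow> braid_eq k w w"
| sym: "braid_eq k u v \<Longrightarrow> braid_eq k v u"
| trans: "braid_eq k u v \<Longrightarrow> braid_eq k v w \<Longrightarrow> braid_eq k u w"
| append: "braid_eq k u v \<Longrightarrow> braid_eq k u' v' \<Longrightarrow> braid_eq k (u @ u') (v @ v')"
| cancel: "Suc i < k \<Longrightarrow> braid_eq k [(i, e), (i, \<not> e)] []"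
| far: "Suc i < j \<Longrightarrow> Suc j < k \<Longrightarrow>
    braid_eq k [(i, True), (j, True)] [(j, True), (i, True)]"
| braid: "Suc (Suc i) < k \<Longrightarrow>
    braid_eq k [(i, True), (Suc i, True), (i, True)] [(Suc i, True), (i, True), (Suc i, True)]"

definition braid_cong :: "nat \<Rightarrow> (braid_word \<times> braid_word) set" where
  "braid_cong k = {(u, v). braid_eq k u v}"

definition braid_group :: "nat \<Rightarrow> braid_word set monoid" where
  "braid_group k =
    \<lparr> carrier = braid_words k // braid_cong k,
      monoid.mult = (\<lambda>A B. \<Union>u\<in>A. \<Union>v\<in>B. braid_cong k `` {u @ v}),
      one = braid_cong k `` {[]} \<rparr>"

lemma append_in_braid_words_iff [simp]:
  "u @ v \<in> braid_words k \<longleftrightarrow> u \<in> braid_words k \<and> v \<in> braid_words k"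
  by (auto simp: braid_words_def)

lemma Nil_in_braid_words [simp]: "[] \<in> braid_words k"
  by (simp add: braid_words_def)

lemma Cons_in_braid_words_iff [simp]:
  "(i, e) # w \<in> braid_words k \<longleftrightarrow> Suc i < k \<and> w \<in> braid_words k"
  by (auto simp: braid_words_def)

lemma braid_eq_words:
  assumes "braid_eq k u v"
  shows "u \<in> braid_words k \<and> v \<in> braid_words k"
  using assms by induction auto

lemma equiv_braid_cong: "equiv (braid_words k) (braid_cong k)"
proof (rule equivI)
  show "braid_cong k \<subseteq> braid_words k \<times> braid_words k"
    by (auto simp: braid_cong_def dest: braid_eq_words)
  show "refl_on (braid_words k) (braid_cong k)"
    by (auto simp: braid_cong_def refl_on_def intro: braid_eq.refl)
  show "sym (braid_cong k)"
    unfolding braid_cong_def sym_def by (blast intro: braid_eq.sym)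
  show "trans (braid_cong k)"
    unfolding braid_cong_def trans_def by (blast intro: braid_eq.trans)
qed

lemma braid_class_eq_iff:
  assumes "u \<in> braid_words k" "v \<in> braid_words k"
  shows "braid_cong k `` {u} = braid_cong k `` {v} \<longleftrightarrow> braid_eq k u v"
  using eq_equiv_class_iff[OF equiv_braid_cong assms] by (simp add: braid_cong_def)

lemma braid_mult_class:
  assumes "u \<in> braid_words k" "v \<in> braid_words k"
  shows "braid_cong k `` {u} \<otimes>\<^bsub>braid_group k\<^esub> braid_cong k `` {v} = braid_cong k `` {u @ v}"
proof -
  have "(\<Union>a\<in>braid_cong k `` {u}. \<Union>b\<in>braid_cong k `` {v}. braid_cong k `` {a @ b})
      = braid_cong k `` {u @ v}"
  proof -
    have *: "braid_cong k `` {a @ b} = braid_cong k `` {u @ v}"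
      if "a \<in> braid_cong k `` {u}" "b \<in> braid_cong k `` {v}" for a b
    proof -
      have "braid_eq k u a" "braid_eq k v b" using that by (simp_all add: braid_cong_def)
      then have "braid_eq k (a @ b) (u @ v)" by (blast intro: braid_eq.append[OF braid_eq.sym braid_eq.sym])
      then show ?thesis using braid_eq_words braid_class_eq_iff by blast
    qed
    have "u \<in> braid_cong k `` {u}" "v \<in> braid_cong k `` {v}"
      using assms by (simp_all add: braid_cong_def braid_eq.refl)
    with * show ?thesis by blast
  qed
  then show ?thesis by (simp add: braid_group_def)
qed

lemma braid_carrierE:
  assumes "B \<in> carrier (braid_group k)"
  obtains w where "w \<in> braid_words k" "B = braid_cong k `` {w}"
  using assms by (auto simp: braid_group_def elim: quotientE)

lemma braid_class_in_carrier:
  "w \<in> braid_words k \<Longrightarrow> braid_cong k `` {w} \<in> carrier (braid_group k)"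
  by (auto simp: braid_group_def intro: quotientI)

lemma braid_word_left_inverse:
  assumes "w \<in> braid_words k"
  shows "\<exists>v \<in> braid_words k. braid_eq k (v @ w) []"
  using assms
proof (induction w)
  case Nil
  then show ?case by (intro bexI[of _ "[]"]) (simp_all add: braid_eq.refl)
next
  case (Cons a w)
  obtain i e where a: "a = (i, e)" by force
  with Cons obtain v where v: "v \<in> braid_words k" "braid_eq k (v @ w) []" by auto
  have i: "Suc i < k" and w: "w \<in> braid_words k" using Cons a by auto
  have "braid_eq k ([(i, \<not> e)] @ [(i, e)]) []"
    using braid_eq.cancel[OF i, of "\<not> e"] by simp
  from braid_eq.append[OF this braid_eq.refl[OF w]]
  have "braid_eq k (v @ ([(i, \<not> e), (i, e)] @ w)) (v @ w)"
    using braid_eq.append[OF braid_eq.refl[OF v(1)]] by fastforce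
  then have "braid_eq k ((v @ [(i, \<not> e)]) @ a # w) []"
    using braid_eq.trans[OF _ v(2)] by (simp add: a)
  then show ?case using v i by (intro bexI[of _ "v @ [(i, \<not> e)]"]) auto
qed

lemma group_braid_group: "group (braid_group k)"
proof (rule groupI)
  have one: "\<one>\<^bsub>braid_group k\<^esub> = braid_cong k `` {[]}"
    by (simp add: braid_group_def)
  show "\<one>\<^bsub>braid_group k\<^esub> \<in> carrier (braid_group k)"
    by (simp add: one braid_class_in_carrier)
  fix A assume A: "A \<in> carrier (braid_group k)"
  then obtain u where u: "u \<in> braid_words k" "A = braid_cong k `` {u}" by (rule braid_carrierE)
  show "\<one>\<^bsub>braid_group k\<^esub> \<otimes>\<^bsub>braid_group k\<^esub> A = A"
    by (simp add: one u braid_mult_class)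
  obtain v where v: "v \<in> braid_words k" "braid_eq k (v @ u) []"
    using braid_word_left_inverse[OF u(1)] by auto
  then show "\<exists>y\<in>carrier (braid_group k). y \<otimes>\<^bsub>braid_group k\<^esub> A = \<one>\<^bsub>braid_group k\<^esub>"
    by (intro bexI[of _ "braid_cong k `` {v}"])
      (simp_all add: u one braid_mult_class braid_class_in_carrier braid_class_eq_iff)
  fix B assume "B \<in> carrier (braid_group k)"
  then obtain v where v: "v \<in> braid_words k" "B = braid_cong k `` {v}" by (rule braid_carrierE)
  show "A \<otimes>\<^bsub>braid_group k\<^esub> B \<in> carrier (braid_group k)"
    by (simp add: u v braid_mult_class braid_class_in_carrier)
  fix C assume "C \<in> carrier (braid_group k)"
  then obtain w where w: "w \<in> braid_words k" "C = braid_cong k `` {w}" by (rule braid_carrierE)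
  show "A \<otimes>\<^bsub>braid_group k\<^esub> B \<otimes>\<^bsub>braid_group k\<^esub> C = A \<otimes>\<^bsub>braid_group k\<^esub> (B \<otimes>\<^bsub>braid_group k\<^esub> C)"
    by (simp add: u v w braid_mult_class)
qed


section \<open>The Hurwitz action\<close>

definition conj_by :: "('a, 'b) monoid_scheme \<Rightarrow> 'a \<Rightarrow> 'a \<Rightarrow> 'a" where
  "conj_by G a b = inv\<^bsub>G\<^esub> b \<otimes>\<^bsub>G\<^esub> a \<otimes>\<^bsub>G\<^esub> b"

fun hurwitz_step :: "('a, 'b) monoid_scheme \<Rightarrow> 'a list \<Rightarrow> nat \<times> bool \<Rightarrow> 'a list" where
  "hurwitz_step G f (i, True) = f[i := f ! Suc i,
      Suc i := inv\<^bsub>G\<^esub> (f ! Suc i) \<otimes>\<^bsub>G\<^esub> (f ! i) \<otimes>\<^bsub>G\<^esub> (f ! Suc i)]"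
| "hurwitz_step G f (i, False) = f[i := (f ! i) \<otimes>\<^bsub>G\<^esub> (f ! Suc i) \<otimes>\<^bsub>G\<^esub> inv\<^bsub>G\<^esub> (f ! i),
      Suc i := f ! i]"

definition hurwitz_word :: "('a, 'b) monoid_scheme \<Rightarrow> 'a list \<Rightarrow> braid_word \<Rightarrow> 'a list" where
  "hurwitz_word G = foldl (hurwitz_step G)"

text \<open>
  Tuples of length \<open>k\<close> are lists of length \<open>k\<close>. All words in a class act in the same way
  (lemma \<open>hurwitz_action_class\<close> below). This is a right action, so
  \<open>\<lambda>b. hurwitz_action G b\<close> reverses products (lemma \<open>hurwitz_action_mult\<close>); orbits and
  stabilizers in the library do not depend on the side.
\<close>

definition hurwitz_action :: "('a, 'b) monoid_scheme \<Rightarrow> braid_word set \<Rightarrow> 'a list \<Rightarrow> 'a list" where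
  "hurwitz_action G B f = the_elem (hurwitz_word G f ` B)"

definition hurwitz_equivalent :: "('a, 'b) monoid_scheme \<Rightarrow> 'a list \<Rightarrow> 'a list \<Rightarrow> bool" where
  "hurwitz_equivalent G f g \<longleftrightarrow> g \<in> orbit (braid_group (length f)) (hurwitz_action G) f"

definition hurwitz_stabilizer :: "('a, 'b) monoid_scheme \<Rightarrow> 'a list \<Rightarrow> braid_word set set" where
  "hurwitz_stabilizer G f = stabilizer (braid_group (length f)) (hurwitz_action G) f"

definition normal_closure :: "('a, 'b) monoid_scheme \<Rightarrow> 'a set \<Rightarrow> 'a set" where
  "normal_closure G X = \<Inter>{H. H \<lhd> G \<and> X \<subseteq> H}"

lemma hurwitz_word_Nil [simp]: "hurwitz_word G f [] = f"
  and hurwitz_word_Cons [simp]: "hurwitz_word G f (a # w) = hurwitz_word G (hurwitz_step G f a) w"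
  and hurwitz_word_append: "hurwitz_word G f (u @ v) = hurwitz_word G (hurwitz_word G f u) v"
  by (simp_all add: hurwitz_word_def)

context group
begin

lemma hurwitz_step_closed:
  assumes "set f \<subseteq> carrier G" "Suc i < length f"
  shows "set (hurwitz_step G f (i, e)) \<subseteq> carrier G
    \<and> length (hurwitz_step G f (i, e)) = length f"
proof -
  have "f ! i \<in> carrier G" "f ! Suc i \<in> carrier G"
    using assms by (auto simp: subset_iff)
  then show ?thesis using assms(1)
    by (cases e) (simp_all add: set_update_subsetI)
qed

lemma hurwitz_word_closed:
  assumes "set f \<subseteq> carrier G" "length f = k" "w \<in> braid_words k"
  shows "set (hurwitz_word G f w) \<subseteq> carrier G \<and> length (hurwitz_word G f w) = k"
  using assms
proof (induction w arbitrary: f)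
  case (Cons a w)
  obtain i e where a: "a = (i, e)" by force
  have "set (hurwitz_step G f a) \<subseteq> carrier G \<and> length (hurwitz_step G f a) = k"
    using hurwitz_step_closed[of f i e] Cons.prems a by auto
  then show ?case using Cons a by auto
qed auto

lemma hurwitz_word_cong:
  assumes "braid_eq k u v" "set f \<subseteq> carrier G" "length f = k"
  shows "hurwitz_word G f u = hurwitz_word G f v"
  using assms
proof (induction arbitrary: f)
  case (append u v u' v')
  have "u \<in> braid_words k" using append by (auto dest: braid_eq_words)
  then have "set (hurwitz_word G f u) \<subseteq> carrier G \<and> length (hurwitz_word G f u) = k"
    using append.prems by (intro hurwitz_word_closed)
  then show ?case using append by (simp add: hurwitz_word_append)
next
  case (cancel i e)
  define a b where "a = f ! i" and "b = f ! Suc i"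
  have ab [simp]: "a \<in> carrier G" "b \<in> carrier G"
    using cancel by (auto simp: a_def b_def subset_iff)
  have [simp]: "b \<otimes> (inv b \<otimes> t) = t" "inv a \<otimes> (a \<otimes> t) = t" if "t \<in> carrier G" for t
    using that by (simp_all add: m_assoc[symmetric])
  have "b \<otimes> (inv b \<otimes> a \<otimes> b) \<otimes> inv b = a" "inv a \<otimes> (a \<otimes> b \<otimes> inv a) \<otimes> a = b"
    by (simp_all add: m_assoc)
  with cancel show ?case
    by (cases e) (auto intro!: nth_equalityI simp: nth_list_update a_def[symmetric] b_def[symmetric])
next
  case (far i j)
  then show ?case
    by (auto intro!: nth_equalityI simp: nth_list_update)
next
  case (braid i)
  define a b c where "a = f ! i" and "b = f ! Suc i" and "c = f ! Suc (Suc i)"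
  have abc: "a \<in> carrier G" "b \<in> carrier G" "c \<in> carrier G"
    using braid by (auto simp: a_def b_def c_def subset_iff)
  have "inv c \<otimes> (inv b \<otimes> a \<otimes> b) \<otimes> c
      = inv (inv c \<otimes> b \<otimes> c) \<otimes> (inv c \<otimes> a \<otimes> c) \<otimes> (inv c \<otimes> b \<otimes> c)"
  proof -
    have [simp]: "c \<otimes> (inv c \<otimes> x) = x" if "x \<in> carrier G" for x
      using that abc by (simp add: m_assoc[symmetric])
    show ?thesis using abc by (simp add: m_assoc inv_mult_group)
  qed
  with braid show ?case
    by (auto intro!: nth_equalityI
        simp: nth_list_update a_def[symmetric] b_def[symmetric] c_def[symmetric])
qed auto

lemma hurwitz_action_class:
  assumes "set f \<subseteq> carrier G" "w \<in> braid_words (length f)"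
  shows "hurwitz_action G (braid_cong (length f) `` {w}) f = hurwitz_word G f w"
proof -
  have "w \<in> braid_cong (length f) `` {w}"
    using assms(2) by (simp add: braid_cong_def braid_eq.refl)
  moreover have "hurwitz_word G f v = hurwitz_word G f w"
    if "v \<in> braid_cong (length f) `` {w}" for v
    using that hurwitz_word_cong[OF _ assms(1) HOL.refl, of w v] by (auto simp: braid_cong_def)
  ultimately have "hurwitz_word G f ` (braid_cong (length f) `` {w}) = {hurwitz_word G f w}"
    by blast
  then show ?thesis by (simp add: hurwitz_action_def)
qed

lemma hurwitz_action_one:
  assumes "set f \<subseteq> carrier G"
  shows "hurwitz_action G \<one>\<^bsub>braid_group (length f)\<^esub> f = f"
  using hurwitz_action_class[OF assms, of "[]"] by (simp add: braid_group_def)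

lemma hurwitz_action_mult:
  assumes "set f \<subseteq> carrier G"
    and "A \<in> carrier (braid_group (length f))" "B \<in> carrier (braid_group (length f))"
  shows "hurwitz_action G (A \<otimes>\<^bsub>braid_group (length f)\<^esub> B) f
    = hurwitz_action G B (hurwitz_action G A f)"
proof -
  obtain u where u: "u \<in> braid_words (length f)" "A = braid_cong (length f) `` {u}"
    using assms(2) by (rule braid_carrierE)
  obtain v where v: "v \<in> braid_words (length f)" "B = braid_cong (length f) `` {v}"
    using assms(3) by (rule braid_carrierE)
  have c: "set (hurwitz_word G f u) \<subseteq> carrier G" "length (hurwitz_word G f u) = length f"
    using hurwitz_word_closed[OF assms(1) HOL.refl u(1)] by auto
  show ?thesis
    using hurwitz_action_class[OF c(1), of v] u v
    by (simp add: braid_mult_class hurwitz_action_class assms(1) c(2) hurwitz_word_append)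
qed

end

end

theory Submission
  imports Defs
begin

text \<open>
  Call an entry of a tuple in \<open>G\<^sub>1 \<oplus> G\<^sub>2\<close> a kernel entry if its second component is trivial.
  Under a Hurwitz move a kernel entry stays a kernel entry and is at most conjugated by an element
  of \<open>K\<close>; this gives part (1). Deleting the kernel entries, i.e. deleting their strands from the
  braid, turns a move between two remaining entries into a Hurwitz move of the shorter tuple, and
  a move involving a kernel entry into no move at all, up to conjugating a first component by an
  element of \<open>N\<close>. As \<open>N\<close> is normal in \<open>K\<close>, such conjugations persist under later moves. So a braid
  from \<open>F\<^sub>1\<close> to \<open>F\<^sub>2\<close> yields \<open>v \<in> B\<^sub>m\<close> that fixes \<open>z\<close> and maps \<open>y\<close> to \<open>y'\<close> up to conjugation by
  \<open>N\<close> in each entry; under the hypothesis of part (2), \<open>v\<close> also fixes \<open>y\<close>.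
\<close>

section \<open>Conjugacy by elements of a subgroup\<close>

definition conj_in :: "('a, 'b) monoid_scheme \<Rightarrow> 'a set \<Rightarrow> 'a \<Rightarrow> 'a \<Rightarrow> bool" where
  "conj_in G S a b \<longleftrightarrow> a \<in> carrier G \<and> (\<exists>k\<in>S. b = conj_by G a k)"

context group
begin

lemma conj_by_closed [simp]:
  "\<lbrakk>a \<in> carrier G; b \<in> carrier G\<rbrakk> \<Longrightarrow> conj_by G a b \<in> carrier G"
  by (simp add: conj_by_def)

lemma conj_by_one_right [simp]: "a \<in> carrier G \<Longrightarrow> conj_by G a \<one> = a"
  and conj_by_one_left [simp]: "a \<in> carrier G \<Longrightarrow> conj_by G \<one> a = \<one>"
  by (simp_all add: conj_by_def)

lemma conj_by_conj_by:
  "\<lbrakk>a \<in> carrier G; k \<in> carrier G; l \<in> carrier G\<rbrakk>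
    \<Longrightarrow> conj_by G (conj_by G a k) l = conj_by G a (k \<otimes> l)"
  by (simp add: conj_by_def m_assoc inv_mult_group)

lemma conj_by_inv_cancel:
  "\<lbrakk>a \<in> carrier G; k \<in> carrier G\<rbrakk> \<Longrightarrow> conj_by G (conj_by G a k) (inv k) = a"
  by (simp add: conj_by_conj_by)

lemma inv_conj_by:
  "\<lbrakk>a \<in> carrier G; k \<in> carrier G\<rbrakk> \<Longrightarrow> inv (conj_by G a k) = conj_by G (inv a) k"
  by (simp add: conj_by_def m_assoc inv_mult_group)

text \<open>Applied to second components, this says that a Hurwitz move neither creates nor destroys
  kernel entries.\<close>

lemma conj_by_eq_one_iff [simp]:
  assumes "a \<in> carrier G" "k \<in> carrier G"
  shows "conj_by G a k = \<one> \<longleftrightarrow> a = \<one>"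
  using conj_by_inv_cancel[OF assms] assms by (metis conj_by_one_left inv_closed)

text \<open>Both signs become conjugations, with conjugator \<open>b\<close> or
  \<open>inv a\<close>, and list indices give way to appends.\<close>

lemma hurwitz_step_split:
  assumes "a \<in> carrier G" "b \<in> carrier G"
  shows "hurwitz_step G (A @ a # b # B) (length A, e) =
    A @ (if e then [b, conj_by G a b] else [conj_by G b (inv a), a]) @ B"
  using assms by (cases e) (simp_all add: conj_by_def list_update_append nth_append)

lemma conj_in_refl:
  assumes "subgroup S G" "a \<in> carrier G"
  shows "conj_in G S a a"
  using assms by (auto simp: conj_in_def subgroup.one_closed intro!: bexI[of _ \<one>])

lemma conj_in_trans:
  assumes "subgroup S G" "conj_in G S a b" "conj_in G S b c"
  shows "conj_in G S a c"
proof -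
  interpret S: subgroup S G by fact
  obtain k l where "k \<in> S" "l \<in> S" "b = conj_by G a k" "c = conj_by G b l"
    using assms by (auto simp: conj_in_def)
  with assms(2) show ?thesis
    by (auto simp: conj_in_def conj_by_conj_by)
qed

lemma conj_in_inv:
  assumes "subgroup S G" "conj_in G S a b"
  shows "conj_in G S (inv a) (inv b)"
  using assms subgroup.mem_carrier by (fastforce simp: conj_in_def inv_conj_by)

text \<open>The conjugator comes from \<open>(a^c)^(b^d) = (a^b)^s\<close> with \<open>s = (c d\<inverse>)^b d\<close>, which lies in
  \<open>S\<close> because \<open>b\<close> normalizes \<open>S\<close>.\<close>

lemma conj_in_conj_by:
  assumes "subgroup S G" "\<And>s. s \<in> S \<Longrightarrow> conj_by G s b \<in> S"
    and "conj_in G S a a'" "conj_in G S b b'"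
  shows "conj_in G S (conj_by G a b) (conj_by G a' b')"
proof -
  interpret S: subgroup S G by fact
  obtain c d where cd: "c \<in> S" "d \<in> S" "a' = conj_by G a c" "b' = conj_by G b d"
    using assms(3,4) by (auto simp: conj_in_def)
  have ab: "a \<in> carrier G" "b \<in> carrier G" using assms(3,4) by (auto simp: conj_in_def)
  define s where "s = conj_by G (c \<otimes> inv d) b \<otimes> d"
  have s: "s \<in> S" unfolding s_def using cd assms(2) by simp
  have [simp]: "b \<otimes> (inv b \<otimes> t) = t" if "t \<in> carrier G" for t
    using that ab by (simp add: m_assoc[symmetric])
  have "b \<otimes> s = c \<otimes> conj_by G b d"
    using cd ab by (simp add: s_def conj_by_def m_assoc)
  then have "conj_by G a' b' = conj_by G (conj_by G a b) s"
    using cd ab s by (simp add: conj_by_conj_by)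
  then show ?thesis using s ab by (auto simp: conj_in_def)
qed

end

section \<open>Entrywise conjugacy along Hurwitz moves\<close>

lemma nth_pair_split:
  assumes "Suc i < length f"
  obtains A a b B where "f = A @ a # b # B" "length A = i"
proof
  show "f = take i f @ f ! i # f ! Suc i # drop (Suc (Suc i)) f"
    using assms by (simp add: Cons_nth_drop_Suc)
  show "length (take i f) = i" using assms by simp
qed

text \<open>The new entries are old ones or conjugates of them, so compatibility of
  \<open>conj_in\<close> with conjugation applies. It needs conjugators normalizing
  \<open>S\<close>; those from \<open>f\<close> lie in \<open>K\<close>. The first conclusion keeps
  this true along a word.\<close>

lemma (in group) hurwitz_step_conj_in:
  assumes S: "subgroup S G" and norm: "\<And>s k. \<lbrakk>s \<in> S; k \<in> K\<rbrakk> \<Longrightarrow> conj_by G s k \<in> S"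
    and K: "subgroup K G" and f: "set f \<subseteq> K" and i: "Suc i < length f"
    and rel: "list_all2 (conj_in G S) f g"
  shows "set (hurwitz_step G f (i, e)) \<subseteq> K"
    and "list_all2 (conj_in G S) (hurwitz_step G f (i, e)) (hurwitz_step G g (i, e))"
proof -
  obtain A a b B where fs: "f = A @ a # b # B" "length A = i"
    using i by (rule nth_pair_split)
  obtain A' a' b' B' where gs: "g = A' @ a' # b' # B'" "length A' = i"
    using i list_all2_lengthD[OF rel] by (metis nth_pair_split)
  have r: "list_all2 (conj_in G S) A A'" "conj_in G S a a'" "conj_in G S b b'"
    "list_all2 (conj_in G S) B B'"
    using rel fs gs by (simp_all add: list_all2_append)
  interpret K: subgroup K G by fact
  interpret S: subgroup S G by fact
  have ab: "a \<in> K" "b \<in> K" using f fs by auto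
  have ab': "a' \<in> carrier G" "b' \<in> carrier G" using r by (auto simp: conj_in_def)
  have "conj_by G x y \<in> K" if "x \<in> K" "y \<in> K" for x y
    using that by (simp add: conj_by_def)
  with f ab show "set (hurwitz_step G f (i, e)) \<subseteq> K"
    using hurwitz_step_split[of a b A B e] by (auto simp: fs)
  have "conj_in G S (conj_by G a b) (conj_by G a' b')"
    by (rule conj_in_conj_by[OF S norm]) (use r ab in auto)
  moreover have "conj_in G S (conj_by G b (inv a)) (conj_by G b' (inv a'))"
    by (rule conj_in_conj_by[OF S norm]) (use r ab conj_in_inv[OF S] in auto)
  ultimately show
    "list_all2 (conj_in G S) (hurwitz_step G f (i, e)) (hurwitz_step G g (i, e))"
    using r ab ab' hurwitz_step_split[of a b A B e] hurwitz_step_split[of a' b' A' B' e]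
    by (auto simp: fs gs intro!: list_all2_appendI)
qed

lemma (in group) hurwitz_word_conj_in:
  assumes "subgroup S G" "\<And>s k. \<lbrakk>s \<in> S; k \<in> K\<rbrakk> \<Longrightarrow> conj_by G s k \<in> S" "subgroup K G"
    and "set f \<subseteq> K" "w \<in> braid_words (length f)" "list_all2 (conj_in G S) f g"
  shows "list_all2 (conj_in G S) (hurwitz_word G f w) (hurwitz_word G g w)"
  using assms(4-)
proof (induction w arbitrary: f g)
  case (Cons l w)
  obtain i e where l: "l = (i, e)" by force
  with Cons.prems have i: "Suc i < length f" by simp
  have "length (hurwitz_step G f (i, e)) = length f" by (cases e) simp_all
  then show ?case
    using Cons.IH[of "hurwitz_step G f l" "hurwitz_step G g l"] Cons.prems
      hurwitz_step_conj_in[OF assms(1-3) Cons.prems(1) i Cons.prems(3), of e]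
    by (simp add: l)
qed simp

lemma (in group) hurwitz_word_in_subgroup:
  assumes "subgroup K G" "set f \<subseteq> K" "w \<in> braid_words (length f)"
  shows "set (hurwitz_word G f w) \<subseteq> K"
  using assms(2,3)
proof (induction w arbitrary: f)
  case (Cons l w)
  obtain i e where l: "l = (i, e)" by force
  interpret K: subgroup K G by fact
  \<comment> \<open>The step lemma is used with \<open>S = K\<close> and \<open>f\<close> paired
    with itself, for the sake of its first conclusion.\<close>
  have "list_all2 (conj_in G K) f f"
    using Cons.prems by (intro list.rel_refl_strong conj_in_refl[OF assms(1)]) auto
  then have "set (hurwitz_step G f (i, e)) \<subseteq> K"
    using Cons.prems l
    by (intro hurwitz_step_conj_in(1)[OF assms(1) _ assms(1), of f i f e]) (auto simp: conj_by_def)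
  moreover have "length (hurwitz_step G f (i, e)) = length f" by (cases e) simp_all
  ultimately show ?case using Cons l by simp
qed simp

section \<open>Kernel entries and deletion of their strands\<close>

definition kernel_part :: "('b, 'd) monoid_scheme \<Rightarrow> ('a \<times> 'b) list \<Rightarrow> 'a list" where
  "kernel_part H F = map fst (filter (\<lambda>p. snd p = \<one>\<^bsub>H\<^esub>) F)"

definition rest_part :: "('b, 'd) monoid_scheme \<Rightarrow> ('a \<times> 'b) list \<Rightarrow> ('a \<times> 'b) list" where
  "rest_part H F = filter (\<lambda>p. snd p \<noteq> \<one>\<^bsub>H\<^esub>) F"

lemma kernel_part_simps [simp]:
  "kernel_part H [] = []"
  "kernel_part H (p # F) = (if snd p = \<one>\<^bsub>H\<^esub> then fst p # kernel_part H F else kernel_part H F)"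
  "kernel_part H (E @ F) = kernel_part H E @ kernel_part H F"
  by (simp_all add: kernel_part_def)

lemma rest_part_simps [simp]:
  "rest_part H [] = []"
  "rest_part H (p # F) = (if snd p = \<one>\<^bsub>H\<^esub> then rest_part H F else p # rest_part H F)"
  "rest_part H (E @ F) = rest_part H E @ rest_part H F"
  by (simp_all add: rest_part_def)

text \<open>About \<open>N\<close>, the braid argument uses that it is a subgroup of
  \<open>K\<close> normalized by \<open>K\<close>; the normal closure enters on
  instantiation.\<close>

locale hurwitz_product = G1: group G1 + G2: group G2
  for G1 :: "('a, 'c) monoid_scheme" and G2 :: "('b, 'd) monoid_scheme" +
  fixes K N :: "'a set"
  assumes subgroup_K: "subgroup K G1" and subgroup_N: "subgroup N G1" and N_subset: "N \<subseteq> K"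
    and N_normal: "\<And>s k. \<lbrakk>s \<in> N; k \<in> K\<rbrakk> \<Longrightarrow> conj_by G1 s k \<in> N"
begin

sublocale K: subgroup K G1 by (rule subgroup_K)
sublocale N: subgroup N G1 by (rule subgroup_N)

lemma conj_by_K: "\<lbrakk>a \<in> K; b \<in> K\<rbrakk> \<Longrightarrow> conj_by G1 a b \<in> K"
  by (simp add: conj_by_def)

lemma conj_by_DirProd:
  assumes "a \<in> carrier G1" "b \<in> carrier G1" "c \<in> carrier G2" "d \<in> carrier G2"
  shows "conj_by (G1 \<times>\<times> G2) (a, c) (b, d) = (conj_by G1 a b, conj_by G2 c d)"
  using assms by (simp add: conj_by_def inv_DirProd[OF G1.group_axioms G2.group_axioms])

text \<open>The invariant of Hurwitz moves that makes conjugation by a kernel entry a conjugation by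
  an element of \<open>N\<close>.\<close>

definition admissible :: "('a \<times> 'b) list \<Rightarrow> bool" where
  "admissible F \<longleftrightarrow> set F \<subseteq> K \<times> carrier G2 \<and> set (kernel_part G2 F) \<subseteq> N"

text \<open>Kernel entries may change places, hence multisets. The word \<open>v\<close> is what
  remains of the braid after deleting kernel strands; it acts exactly on second components but only
  modulo conjugation by \<open>N\<close> on first ones.\<close>

definition linked :: "('a \<times> 'b) list \<Rightarrow> ('a \<times> 'b) list \<Rightarrow> bool" where
  "linked F F' \<longleftrightarrow>
    rel_mset (conj_in G1 K) (mset (kernel_part G2 F)) (mset (kernel_part G2 F')) \<and>
    (\<exists>v \<in> braid_words (length (rest_part G2 F)).
      hurwitz_word G2 (map snd (rest_part G2 F)) v = map snd (rest_part G2 F') \<and>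
      list_all2 (conj_in G1 N) (hurwitz_word G1 (map fst (rest_part G2 F)) v)
        (map fst (rest_part G2 F')))"

lemma rel_mset_conj_in_refl:
  "set xs \<subseteq> K \<Longrightarrow> rel_mset (conj_in G1 K) (mset xs) (mset xs)"
  by (rule multiset.rel_refl_strong) (auto intro!: G1.conj_in_refl[OF subgroup_K])

lemma list_all2_conj_in_refl:
  "set xs \<subseteq> K \<Longrightarrow> list_all2 (conj_in G1 N) xs xs"
  by (rule list.rel_refl_strong) (auto intro!: G1.conj_in_refl[OF subgroup_N])

lemma admissible_carrier:
  assumes "admissible F"
  shows "set (kernel_part G2 F) \<subseteq> K" "set (map fst (rest_part G2 F)) \<subseteq> K"
    "set (map snd (rest_part G2 F)) \<subseteq> carrier G2"
  using assms by (auto simp: admissible_def kernel_part_def rest_part_def)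

lemma linked_refl: "admissible F \<Longrightarrow> linked F F"
  unfolding linked_def
  using rel_mset_conj_in_refl list_all2_conj_in_refl admissible_carrier
  by (metis Nil_in_braid_words hurwitz_word_Nil)

text \<open>The words are concatenated. The second one now starts from a tuple that agrees with the
  rest of \<open>F\<close> only up to \<open>N\<close>, an error that its action preserves.\<close>

lemma linked_trans:
  assumes "linked E F" "linked F F'" "admissible E"
  shows "linked E F'"
proof -
  have "rel_mset (conj_in G1 K OO conj_in G1 K)
      (mset (kernel_part G2 E)) (mset (kernel_part G2 F'))"
    using assms(1,2) by (auto simp: linked_def multiset.rel_compp)
  then have 1: "rel_mset (conj_in G1 K) (mset (kernel_part G2 E)) (mset (kernel_part G2 F'))"
    by (rule multiset.rel_mono_strong) (auto intro: G1.conj_in_trans[OF subgroup_K])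
  obtain u where u: "u \<in> braid_words (length (rest_part G2 E))"
    "hurwitz_word G2 (map snd (rest_part G2 E)) u = map snd (rest_part G2 F)"
    "list_all2 (conj_in G1 N) (hurwitz_word G1 (map fst (rest_part G2 E)) u)
      (map fst (rest_part G2 F))"
    using assms(1) by (auto simp: linked_def)
  obtain v where v: "v \<in> braid_words (length (rest_part G2 F))"
    "hurwitz_word G2 (map snd (rest_part G2 F)) v = map snd (rest_part G2 F')"
    "list_all2 (conj_in G1 N) (hurwitz_word G1 (map fst (rest_part G2 F)) v)
      (map fst (rest_part G2 F'))"
    using assms(2) by (auto simp: linked_def)
  let ?y = "hurwitz_word G1 (map fst (rest_part G2 E)) u"
  have y: "set ?y \<subseteq> K"
    using G1.hurwitz_word_in_subgroup[OF subgroup_K] admissible_carrier[OF assms(3)] u(1) by simp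
  have E: "set (map fst (rest_part G2 E)) \<subseteq> carrier G1"
    using admissible_carrier[OF assms(3)] by auto
  have len: "length ?y = length (rest_part G2 E)"
    using G1.hurwitz_word_closed[OF E _ u(1)] by simp
  have len': "length (rest_part G2 F) = length (rest_part G2 E)"
    using list_all2_lengthD[OF u(3)] len by simp
  have "list_all2 (conj_in G1 N) (hurwitz_word G1 ?y v)
      (hurwitz_word G1 (map fst (rest_part G2 F)) v)"
    using G1.hurwitz_word_conj_in[OF subgroup_N N_normal subgroup_K y _ u(3)] v(1) len len'
    by simp
  then have "list_all2 (conj_in G1 N) (hurwitz_word G1 ?y v) (map fst (rest_part G2 F'))"
    using v(3) by (rule list_all2_trans[rotated]) (rule G1.conj_in_trans[OF subgroup_N])
  with 1 u v len' show ?thesis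
    unfolding linked_def by (intro conjI bexI[of _ "u @ v"]) (simp_all add: hurwitz_word_append)
qed

text \<open>If one of the two entries is a kernel entry, the rest keeps its order and the empty word
  serves; otherwise the move survives as a single letter.\<close>

lemma linked_step:
  assumes F: "admissible F" and i: "Suc i < length F"
  shows "admissible (hurwitz_step (G1 \<times>\<times> G2) F (i, e)) \<and>
    linked F (hurwitz_step (G1 \<times>\<times> G2) F (i, e))"
proof -
  interpret P: group "G1 \<times>\<times> G2" by (rule DirProd_group) unfold_locales
  obtain A p q B where s: "F = A @ p # q # B" "length A = i"
    using i by (rule nth_pair_split)
  obtain a c where p: "p = (a, c)" by force
  obtain b d where q: "q = (b, d)" by force
  have K: "a \<in> K" "b \<in> K" "c \<in> carrier G2" "d \<in> carrier G2"
    using F s p q by (auto simp: admissible_def)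
  have N: "c = \<one>\<^bsub>G2\<^esub> \<Longrightarrow> a \<in> N" "d = \<one>\<^bsub>G2\<^esub> \<Longrightarrow> b \<in> N"
    using F s p q by (auto simp: admissible_def)
  have AB: "admissible A" "admissible B"
    using F s by (auto simp: admissible_def)
  define F' where "F' = A @ (if e then [(b, d), (conj_by G1 a b, conj_by G2 c d)]
    else [(conj_by G1 b (inv\<^bsub>G1\<^esub> a), conj_by G2 d (inv\<^bsub>G2\<^esub> c)), (a, c)]) @ B"
  have step: "hurwitz_step (G1 \<times>\<times> G2) F (i, e) = F'"
    using P.hurwitz_step_split[of p q A B e] K
    by (simp add: s p q F'_def conj_by_DirProd inv_DirProd[OF G1.group_axioms G2.group_axioms])
  have "admissible F'"
    using AB K N by (auto simp: F'_def admissible_def conj_by_K N_normal)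
  moreover have "rel_mset (conj_in G1 K) (mset (kernel_part G2 F)) (mset (kernel_part G2 F'))"
  proof -
    let ?M = "mset (kernel_part G2 A) + mset (kernel_part G2 B)"
    have M: "rel_mset (conj_in G1 K) ?M ?M"
      using AB rel_mset_conj_in_refl[of "kernel_part G2 A @ kernel_part G2 B"]
      by (auto dest: admissible_carrier)
    have C: "conj_in G1 K a (conj_by G1 a b)" "conj_in G1 K b (conj_by G1 b (inv\<^bsub>G1\<^esub> a))"
      "conj_in G1 K a a" "conj_in G1 K b b"
      using K G1.conj_in_refl[OF subgroup_K] by (auto simp: conj_in_def)
    \<comment> \<open>If both are kernel entries, the move swaps them; reordering the right side
      pairs each with its own conjugate.\<close>
    have "rel_mset (conj_in G1 K) (add_mset a (add_mset b ?M))
        (add_mset b (add_mset (conj_by G1 a b) ?M))"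
      by (subst (2) add_mset_commute) (intro rel_mset_Plus C M)
    moreover have "rel_mset (conj_in G1 K) (add_mset a (add_mset b ?M))
        (add_mset (conj_by G1 b (inv\<^bsub>G1\<^esub> a)) (add_mset a ?M))"
      by (subst (2) add_mset_commute) (intro rel_mset_Plus C M)
    ultimately show ?thesis
      using K C M by (auto simp: s p q F'_def intro: rel_mset_Plus)
  qed
  moreover have "\<exists>v \<in> braid_words (length (rest_part G2 F)).
      hurwitz_word G2 (map snd (rest_part G2 F)) v = map snd (rest_part G2 F') \<and>
      list_all2 (conj_in G1 N) (hurwitz_word G1 (map fst (rest_part G2 F)) v)
        (map fst (rest_part G2 F'))"
  proof (cases "c = \<one>\<^bsub>G2\<^esub> \<or> d = \<one>\<^bsub>G2\<^esub>")
    case True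
    have "list_all2 (conj_in G1 N) (map fst (rest_part G2 A)) (map fst (rest_part G2 A))"
      "list_all2 (conj_in G1 N) (map fst (rest_part G2 B)) (map fst (rest_part G2 B))"
      using AB by (auto intro!: list_all2_conj_in_refl dest: admissible_carrier)
    \<comment> \<open>An entry passing a kernel entry is conjugated by an element of
      \<open>N\<close> at most; its second component is conjugated by the identity and stays
      fixed.\<close>
    moreover have "conj_in G1 N a (conj_by G1 a b)" if "d = \<one>\<^bsub>G2\<^esub>"
      using K N that by (auto simp: conj_in_def)
    moreover have "conj_in G1 N b (conj_by G1 b (inv\<^bsub>G1\<^esub> a))" if "c = \<one>\<^bsub>G2\<^esub>"
      using K N that by (auto simp: conj_in_def)
    moreover have "conj_in G1 N a a" "conj_in G1 N b b"
      using K G1.conj_in_refl[OF subgroup_N] by auto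
    ultimately show ?thesis
      using True K
      by (intro bexI[of _ "[]"]) (auto simp: s p q F'_def intro!: list_all2_appendI)
  next
    case False
    \<comment> \<open>Deleting kernel strands leaves this many strands before the pair.\<close>
    let ?i = "length (rest_part G2 A)"
    have 1: "hurwitz_word G2 (map snd (rest_part G2 F)) [(?i, e)] = map snd (rest_part G2 F')"
      using False K G2.hurwitz_step_split[of c d "map snd (rest_part G2 A)" _ e]
      by (auto simp: s p q F'_def)
    have 2: "hurwitz_word G1 (map fst (rest_part G2 F)) [(?i, e)] = map fst (rest_part G2 F')"
      using False K G1.hurwitz_step_split[of a b "map fst (rest_part G2 A)" _ e]
      by (auto simp: s p q F'_def)
    have "set (map fst (rest_part G2 F')) \<subseteq> K"
      using \<open>admissible F'\<close> by (rule admissible_carrier)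
    then show ?thesis
      using 1 2 False list_all2_conj_in_refl
      by (intro bexI[of _ "[(?i, e)]"]) (simp_all add: s p q)
  qed
  ultimately show ?thesis by (simp add: step linked_def)
qed

lemma linked_word:
  assumes "admissible F" "w \<in> braid_words (length F)"
  shows "linked F (hurwitz_word (G1 \<times>\<times> G2) F w)"
  using assms
proof (induction w arbitrary: F)
  case (Cons l w)
  obtain i e where l: "l = (i, e)" by force
  have "length (hurwitz_step (G1 \<times>\<times> G2) F (i, e)) = length F" by (cases e) simp_all
  then show ?case
    using Cons linked_step[of F i e] by (auto simp: l intro: linked_trans)
qed (simp add: linked_refl)

end

section \<open>Matchings as permutations, and normal closures\<close>

lemma rel_mset_permutation:
  assumes "rel_mset R (mset xs) (mset ys)"
  obtains p where "p permutes {..<length ys}" "\<forall>i<length ys. R (xs ! p i) (ys ! i)"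
proof -
  obtain us vs where uv: "mset us = mset xs" "mset vs = mset ys" "list_all2 R us vs"
    using assms by (auto simp: rel_mset_def)
  \<comment> \<open>The reordering fact prescribes the left list, whereas here the right one must
    become \<open>ys\<close>; hence the converse relation.\<close>
  obtain ws where ws: "list_all2 R ws ys" "mset ws = mset xs"
    using list_all2_reorder_left_invariance[of "R\<inverse>\<inverse>" vs us ys] uv
    by (auto simp: list.rel_flip)
  obtain p where p: "p permutes {..<length xs}" "permute_list p xs = ws"
    using ws(2) by (rule mset_eq_permutation)
  have len: "length xs = length ys"
    using ws by (metis list_all2_lengthD mset_eq_length)
  have "R (xs ! p i) (ys ! i)" if "i < length ys" for i
    using list_all2_nthD2[OF ws(1) that] p len that by (auto simp: permute_list_nth)
  with p(1) len that show thesis by simp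
qed

lemma (in group) normal_closure_normal:
  assumes "X \<subseteq> carrier G"
  shows "normal_closure G X \<lhd> G" and "X \<subseteq> normal_closure G X"
proof -
  let ?A = "{H. H \<lhd> G \<and> X \<subseteq> H}"
  \<comment> \<open>The family is nonempty, so its intersection is a subgroup.\<close>
  have "carrier G \<in> ?A" using assms normal_self by simp
  then have "subgroup (\<Inter>?A) G"
    by (intro subgroups_Inter) (auto simp: normal_imp_subgroup)
  then show "normal_closure G X \<lhd> G"
    unfolding normal_closure_def normal_inv_iff by (auto simp: normal_inv_iff)
  show "X \<subseteq> normal_closure G X" by (auto simp: normal_closure_def)
qed

section \<open>Both claims, from a braid taking \<open>F1\<close> to \<open>F2\<close>\<close>

theorem theorem3p5:
  fixes G1 :: "('a, 'c) monoid_scheme" and G2 :: "('b, 'd) monoid_scheme"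
    and n m :: nat and x x' y y' :: "'a list" and z :: "'b list"
  defines "G \<equiv> G1 \<times>\<times> G2"
    and "F1 \<equiv> map (\<lambda>a. (a, \<one>\<^bsub>G2\<^esub>)) x @ zip y z"
    and "F2 \<equiv> map (\<lambda>a. (a, \<one>\<^bsub>G2\<^esub>)) x' @ zip y' z"
    and "K \<equiv> generate G1 (set x \<union> set y)"
    and "N \<equiv> normal_closure (G1\<lparr>carrier := generate G1 (set x \<union> set y)\<rparr>) (set x)"
  assumes "group G1" and "group G2"
    and "length x = n" and "length x' = n"
    and "length y = m" and "length y' = m" and "length z = m"
    and "set x \<subseteq> carrier G1" and "set x' \<subseteq> carrier G1"
    and "set y \<subseteq> carrier G1" and "set y' \<subseteq> carrier G1"
    and "set z \<subseteq> carrier G2"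
    and "hurwitz_equivalent G F1 F2"
    and "\<forall>i<m. z ! i \<noteq> \<one>\<^bsub>G2\<^esub>"
  shows "(\<exists>\<pi>. \<pi> permutes {..<n} \<and>
            (\<forall>i<n. (\<exists>k\<in>K. x' ! i = conj_by G1 (x ! \<pi> i) k) \<and> x' ! i \<in> N)) \<and>
         (hurwitz_stabilizer G2 z \<subseteq> hurwitz_stabilizer G1 y \<longrightarrow>
            (\<forall>i<m. \<exists>c\<in>N. y' ! i = conj_by G1 (y ! i) c))"
proof -
  interpret G1: group G1 by fact
  interpret G2: group G2 by fact
  interpret G: group G unfolding G_def by (rule DirProd_group) unfold_locales
  have xy: "set x \<union> set y \<subseteq> carrier G1" using assms by simp
  have subK: "subgroup K G1" unfolding K_def using xy by (rule G1.generate_is_subgroup)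
  interpret K: subgroup K G1 by fact
  let ?K = "G1\<lparr>carrier := K\<rparr>"
  interpret KG: group ?K by (rule G1.subgroup_imp_group[OF subK])
  have xyK: "set x \<subseteq> K" "set y \<subseteq> K" by (auto simp: K_def intro: generate.incl)
  have normN: "N \<lhd> ?K" and xN: "set x \<subseteq> N"
    using KG.normal_closure_normal[of "set x"] xyK by (simp_all add: N_def K_def)
  interpret N: normal N ?K by fact
  \<comment> \<open>Inverses in \<open>?K\<close> agree with those in \<open>G1\<close>, so
    normality in \<open>?K\<close> carries over to \<open>conj_by G1\<close>.\<close>
  have "conj_by G1 s k \<in> N" if "s \<in> N" "k \<in> K" for s k
    using N.inv_op_closed1[of k s] that subK by (simp add: conj_by_def)
  then interpret hurwitz_product G1 G2 K N
    using assms(6,7) subK G1.incl_subgroup[OF subK N.subgroup_axioms] N.subset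
    by (intro hurwitz_product.intro hurwitz_product_axioms.intro) auto
  have z1: "\<one>\<^bsub>G2\<^esub> \<notin> set z" using assms by (auto simp: in_set_conv_nth)
  \<comment> \<open>As no entry of \<open>z\<close> is trivial, the kernel entries are exactly the
    first block.\<close>
  have parts: "kernel_part G2 (map (\<lambda>a. (a, \<one>\<^bsub>G2\<^esub>)) u @ zip v z) = u"
    "rest_part G2 (map (\<lambda>a. (a, \<one>\<^bsub>G2\<^esub>)) u @ zip v z) = zip v z" for u v
    using z1 by (auto simp: kernel_part_def rest_part_def filter_map o_def
        filter_empty_conv filter_id_conv dest: set_zip_rightD)
  have F1: "admissible F1"
    unfolding admissible_def F1_def parts(1)
    using xyK xN assms(17) by (auto dest: set_zip_leftD set_zip_rightD)
  obtain B where B: "B \<in> carrier (braid_group (length F1))" "F2 = hurwitz_action G B F1"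
    using assms(18) by (auto simp: hurwitz_equivalent_def orbit_def)
  obtain w where w: "w \<in> braid_words (length F1)" "B = braid_cong (length F1) `` {w}"
    using B(1) by (rule braid_carrierE)
  have "set F1 \<subseteq> carrier G"
    using F1 by (auto simp: admissible_def G_def)
  then have "F2 = hurwitz_word G F1 w"
    using B w by (simp add: G.hurwitz_action_class)
  then have L: "linked F1 F2"
    using linked_word[OF F1 w(1)] by (simp add: G_def)
  note L' = L[unfolded linked_def F1_def F2_def parts]
  then have "rel_mset (conj_in G1 K) (mset x) (mset x')" by simp
  then obtain p where p: "p permutes {..<n}" "\<forall>i<n. conj_in G1 K (x ! p i) (x' ! i)"
    using assms rel_mset_permutation by metis
  have "(\<exists>k\<in>K. x' ! i = conj_by G1 (x ! p i) k) \<and> x' ! i \<in> N" if "i < n" for i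
  proof -
    \<comment> \<open>\<open>N\<close> is normalized by \<open>K\<close>, so the conjugate
      \<open>x' ! i\<close> lies in \<open>N\<close> as well.\<close>
    have "x ! p i \<in> N" using xN p(1) that assms(8) permutes_in_image[of p] by fastforce
    then show ?thesis using p(2) that N_normal by (auto simp: conj_in_def)
  qed
  moreover have "\<forall>i<m. \<exists>c\<in>N. y' ! i = conj_by G1 (y ! i) c"
    if stab: "hurwitz_stabilizer G2 z \<subseteq> hurwitz_stabilizer G1 y"
  proof -
    \<comment> \<open>Both rest parts have second components \<open>z\<close>, so \<open>v\<close>
      fixes \<open>z\<close>. By \<open>stab\<close> it then fixes \<open>y\<close>, and the
      relation to \<open>y'\<close> becomes the claim.\<close>
    obtain v where v: "v \<in> braid_words m" "hurwitz_word G2 z v = z"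
      "list_all2 (conj_in G1 N) (hurwitz_word G1 y v) y'"
      using L' assms(8-12) by auto
    have "braid_cong m `` {v} \<in> hurwitz_stabilizer G2 z"
      using v(1,2) assms(12,17) G2.hurwitz_action_class[of z v]
      by (simp add: hurwitz_stabilizer_def stabilizer_def braid_class_in_carrier)
    with stab have "braid_cong m `` {v} \<in> hurwitz_stabilizer G1 y" by blast
    then have "hurwitz_word G1 y v = y"
      using v(1) assms(10,15) G1.hurwitz_action_class[of y v]
      by (simp add: hurwitz_stabilizer_def stabilizer_def)
    with v(3) show ?thesis
      using assms(10) by (auto simp: list_all2_conv_all_nth conj_in_def)
  qed
  ultimately show ?thesis using p(1) by blast
qed

end
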